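(* Let $\pi$ be a probability measure on $\mathsf{E}=\mathbb{R}^d$ with a positive density with respect to Lebesgue measure, let $\mathsf{d}$ be a metric on $\mathsf{E}$, and let $\tilde I_\pi:(0,1)\to(0,\infty)$ be symmetric about $\frac12$, continuous, and monotone increasing on $(0,\frac12]$. Then the following are equivalent: (i) $\tilde I_\pi$ is a (regular) isoperimetric minorant of $\pi$ with respect to the metric $\mathsf{d}$; (ii) $\pi$ satisfies a three-set isoperimetric inequality with metric $\mathsf{d}$ and function $F=\tilde I_\pi$ on $(0,\frac12]$.
   Context: For Borel $A$ and $r\ge0$, $A_r:=\{x\in\mathsf{E}:\mathsf{d}(x,A)<r\}$; the Minkowski content is $\pi^+(A)=\liminf_{r\to0^+}\frac{\pi(A_r)-\pi(A)}{r}$; the isoperimetric profile is $I_\pi(p):=\inf\{\pi^+(A):A\text{ Borel},\pi(A)=p\}$, $p\in(0,1)$. A function $\tilde I_\pi:(0,1)\to(0,\infty)$ is an isoperimetric minorant of $\pi$ w.r.t. $\mathsf{d}$ if $\tilde I_\pi\le I_\pi$ pointwise; it is regular if it is symmetric about $\frac12$, continuous, and monotone increasing on $(0,\frac12]$. $\pi$ satisfies a three-set isoperimetric inequality with metric $\mathsf{d}$ and function $F:(0,\frac12]\to[0,\infty)$ if for all measurable partitions $\mathsf{E}=S_1\sqcup S_2\sqcup S_3$ with $\pi(S_1),\pi(S_2)>0$, $\pi(S_3)\ge\mathsf{d}(S_1,S_2)\cdot F(\min\{\pi(S_1),\pi(S_2)\})$, where $\mathsf{d}(A,B):=\inf\{\mathsf{d}(x,y):x\in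 A,y\in B\}$. *)

theory Defs
  imports "HOL-Probability.Probability"
begin

text \<open>
  The metric is a function argument \<open>d\<close>, independent of the Euclidean distance of the type.
  Distances to sets are extended reals, so that the infimum over the empty set is \<open>\<infinity>\<close>.
\<close>

definition set_distance :: "('a \<Rightarrow> 'a \<Rightarrow> real) \<Rightarrow> 'a set \<Rightarrow> 'a set \<Rightarrow> ereal" where
  "set_distance d A B = (INF x\<in>A. INF y\<in>B. ereal (d x y))"

definition enlargement :: "('a \<Rightarrow> 'a \<Rightarrow> real) \<Rightarrow> 'a set \<Rightarrow> real \<Rightarrow> 'a set" where
  "enlargement d A r = {x. set_distance d {x} A < ereal r}"

text \<open>
  Since \<open>d\<close> need not induce the topology behind \<open>sets \<pi>\<close>, the enlargements of a measurable
  set need not be measurable, and \<open>measure\<close> is \<open>0\<close> on non-measurable sets. The content is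
  meaningful only if the enlargements of \<open>A\<close> lie in \<open>sets \<pi>\<close>.
\<close>

definition minkowski_content :: "'a measure \<Rightarrow> ('a \<Rightarrow> 'a \<Rightarrow> real) \<Rightarrow> 'a set \<Rightarrow> ereal" where
  "minkowski_content \<pi> d A =
     Liminf (at_right 0) (\<lambda>r. ereal ((measure \<pi> (enlargement d A r) - measure \<pi> A) / r))"

definition isoperimetric_profile :: "'a measure \<Rightarrow> ('a \<Rightarrow> 'a \<Rightarrow> real) \<Rightarrow> real \<Rightarrow> ereal" where
  "isoperimetric_profile \<pi> d p =
     (INF A\<in>{A \<in> sets \<pi>. measure \<pi> A = p}. minkowski_content \<pi> d A)"

definition isoperimetric_minorant ::
    "'a measure \<Rightarrow> ('a \<Rightarrow> 'a \<Rightarrow> real) \<Rightarrow> (real \<Rightarrow> real) \<Rightarrow> bool" where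
  "isoperimetric_minorant \<pi> d J \<longleftrightarrow>
     J \<in> {0<..<1} \<rightarrow> {0<..} \<and>
     (\<forall>p\<in>{0<..<1}. ereal (J p) \<le> isoperimetric_profile \<pi> d p)"

definition regular_isoperimetric_minorant ::
    "'a measure \<Rightarrow> ('a \<Rightarrow> 'a \<Rightarrow> real) \<Rightarrow> (real \<Rightarrow> real) \<Rightarrow> bool" where
  "regular_isoperimetric_minorant \<pi> d J \<longleftrightarrow>
     isoperimetric_minorant \<pi> d J \<and>
     (\<forall>p\<in>{0<..<1}. J (1 - p) = J p) \<and>
     continuous_on {0<..<1} J \<and>
     mono_on {0<..1/2} J"

definition three_set_isoperimetric ::
    "'a measure \<Rightarrow> ('a \<Rightarrow> 'a \<Rightarrow> real) \<Rightarrow> (real \<Rightarrow> real) \<Rightarrow> bool" where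
  "three_set_isoperimetric \<pi> d F \<longleftrightarrow>
     F \<in> {0<..1/2} \<rightarrow> {0..} \<and>
     (\<forall>S1\<in>sets \<pi>. \<forall>S2\<in>sets \<pi>. \<forall>S3\<in>sets \<pi>.
        S1 \<union> S2 \<union> S3 = space \<pi> \<and>
        S1 \<inter> S2 = {} \<and> S1 \<inter> S3 = {} \<and> S2 \<inter> S3 = {} \<and>
        measure \<pi> S1 > 0 \<and> measure \<pi> S2 > 0 \<longrightarrow>
        ereal (measure \<pi> S3) \<ge>
          set_distance d S1 S2 * ereal (F (min (measure \<pi> S1) (measure \<pi> S2))))"

end

theory Submission imports Defs begin

text \<open>
  For a set \<open>A\<close> the function \<open>g r = measure \<pi> (enlargement d A r)\<close>, \<open>g 0 = measure \<pi> A\<close>, is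
  monotone, and since the \<open>s\<close>-enlargement of the \<open>r\<close>-enlargement lies in the \<open>(r + s)\<close>-enlargement,
  an isoperimetric minorant bounds the lower right Dini derivative of \<open>g\<close> from below. A monotone
  function has only upward jumps, so the bound integrates up to r = d(S1, S2) without any
  continuity of \<open>g\<close>. Conversely, the three-set inequality for \<open>A\<close>, the complement of its
  \<open>r\<close>-enlargement and the shell in between bounds the difference quotient of the content, and
  continuity of the minorant handles the limit.
\<close>

section \<open>Enlargements and distances between sets\<close>

lemma enlargement_eq: "enlargement d A r = {x. \<exists>y\<in>A. d x y < r}"
  by (auto simp: enlargement_def set_distance_def INF_less_iff)

lemma subset_enlargement:
  assumes "Metric_space UNIV d" and "r > 0"
  shows "A \<subseteq> enlargement d A r"
proof -
  interpret Metric_space UNIV d by fact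
  show ?thesis using \<open>r > 0\<close> by (force simp: enlargement_eq)
qed

lemma enlargement_mono: "r \<le> s \<Longrightarrow> enlargement d A r \<subseteq> enlargement d A s"
  by (force simp: enlargement_eq)

text \<open>This is the triangle inequality. For a general metric only this inclusion is available,
  since intermediate points may be missing.\<close>

lemma enlargement_enlargement_subset:
  assumes "Metric_space UNIV d"
  shows "enlargement d (enlargement d A r) s \<subseteq> enlargement d A (r + s)"
proof -
  interpret Metric_space UNIV d by fact
  show ?thesis
  proof
    fix x assume "x \<in> enlargement d (enlargement d A r) s"
    then obtain y z where "z \<in> A" "d x y < s" "d y z < r"
      by (auto simp: enlargement_eq)
    moreover have "d x z \<le> d x y + d y z" by (rule triangle) auto
    ultimately show "x \<in> enlargement d A (r + s)"
      by (force simp: enlargement_eq)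
  qed
qed

lemma le_set_distance_iff: "c \<le> set_distance d A B \<longleftrightarrow> (\<forall>x\<in>A. \<forall>y\<in>B. c \<le> ereal (d x y))"
  by (auto simp: set_distance_def le_INF_iff)

lemma le_set_distance_compl_enlargement:
  assumes "Metric_space UNIV d"
  shows "ereal r \<le> set_distance d A (- enlargement d A r)"
proof -
  interpret Metric_space UNIV d by fact
  show ?thesis by (force simp: le_set_distance_iff enlargement_eq commute)
qed

text \<open>Enlargements are defined by a strict inequality, so \<open>r\<close> may equal the
  distance itself. That endpoint is used later for \<open>g_bounds\<close> at
  \<open>D\<close>.\<close>

lemma enlargement_disjoint:
  assumes "Metric_space UNIV d" and "ereal r \<le> set_distance d A B"
  shows "enlargement d A r \<inter> B = {}"
proof -
  interpret Metric_space UNIV d by fact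
  show ?thesis
    using assms(2) by (force simp: le_set_distance_iff enlargement_eq commute)
qed

section \<open>Monotone functions on an interval and the shape of \<open>J\<close>\<close>

text \<open>Continuous induction: the points whose chord from \<open>a\<close> has slope at least
  \<open>c < m\<close> contain their supremum by monotonicity, and the Dini bound moves past any
  such point below \<open>b\<close>.\<close>

lemma mono_Dini_lower_bound:
  fixes g :: "real \<Rightarrow> real"
  assumes "a \<le> b" and "m > 0" and mono: "mono_on {a..b} g"
    and Dini: "\<And>t. t \<in> {a..<b} \<Longrightarrow>
      ereal m \<le> Liminf (at_right 0) (\<lambda>s. ereal ((g (t + s) - g t) / s))"
  shows "m * (b - a) \<le> g b - g a"
proof (cases "a = b")
  case False
  with \<open>a \<le> b\<close> have "a < b" by simp
  \<comment> \<open>A liminf of at least \<open>m\<close> makes the quotients eventually exceed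
    \<open>c\<close> only for \<open>c\<close> strictly below \<open>m\<close>. Density of the reals
    recovers \<open>m\<close> at the end.\<close>
  have "c \<le> (g b - g a) / (b - a)" if c: "0 < c" "c < m" for c
  proof -
    define T where "T = {t\<in>{a..b}. c * (t - a) \<le> g t - g a}"
    define u where "u = Sup T"
    have aT: "a \<in> T" using \<open>a \<le> b\<close> by (simp add: T_def)
    have bdd: "bdd_above T" by (rule bdd_aboveI[of _ b]) (simp add: T_def)
    have "a \<le> u" unfolding u_def using aT bdd by (rule cSup_upper)
    have "u \<le> b" unfolding u_def using aT by (intro cSup_least) (auto simp: T_def)
    have uT: "u \<in> T"
    proof -
      \<comment> \<open>Replacing \<open>g t\<close> by the larger \<open>g u\<close> gives a bound
        independent of \<open>t\<close>, which therefore passes to the supremum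
        \<open>u\<close>.\<close>
      have "t \<le> a + (g u - g a) / c" if "t \<in> T" for t
      proof -
        have "t \<le> u" unfolding u_def using that bdd by (rule cSup_upper)
        then have "g t \<le> g u"
          using that \<open>u \<le> b\<close> \<open>a \<le> u\<close> by (intro mono_onD[OF mono]) (auto simp: T_def)
        with that have "c * (t - a) \<le> g u - g a" by (simp add: T_def)
        with c show ?thesis by (simp add: field_simps)
      qed
      then have "u \<le> a + (g u - g a) / c"
        unfolding u_def using aT by (intro cSup_least) auto
      then show ?thesis
        using c \<open>a \<le> u\<close> \<open>u \<le> b\<close> by (simp add: T_def field_simps)
    qed
    have "u = b"
    proof (rule ccontr)
      assume "u \<noteq> b"
      with \<open>u \<le> b\<close> have "u < b" by simp
      have "\<forall>\<^sub>F s in at_right 0. ereal c < ereal ((g (u + s) - g u) / s)"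
        using \<open>a \<le> u\<close> \<open>u < b\<close> c by (intro less_LiminfD less_le_trans[OF _ Dini]) auto
      moreover have "\<forall>\<^sub>F s in at_right 0. s \<in> {0<..<b - u}"
        using \<open>u < b\<close> by (intro eventually_at_right_real) simp
      ultimately have "\<forall>\<^sub>F s in at_right (0::real). s \<in> {0<..<b - u} \<and> c < (g (u + s) - g u) / s"
        by eventually_elim simp
      then obtain s where s: "0 < s" "s < b - u" "c < (g (u + s) - g u) / s"
        by (auto dest!: eventually_happens'[rotated])
      from s have "c * s < g (u + s) - g u" by (simp add: field_simps)
      with uT s have "u + s \<in> T" by (auto simp: T_def algebra_simps)
      then have "u + s \<le> u" unfolding u_def using bdd by (rule cSup_upper)
      with s show False by simp
    qed
    with uT have "c * (b - a) \<le> g b - g a" by (simp add: T_def)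
    with \<open>a < b\<close> show ?thesis by (simp add: field_simps)
  qed
  then have "m \<le> (g b - g a) / (b - a)"
    by (rule dense_le_bounded[OF \<open>m > 0\<close>])
  with \<open>a < b\<close> show ?thesis by (simp add: field_simps)
qed simp

text \<open>Reflection at 1/2 moves an argument \<open>p\<close> above 1/2 to \<open>1 - p\<close>,
  which is at least \<open>b\<close> and lies in the range of monotonicity.\<close>

lemma symmetric_mono_ge_min:
  fixes J :: "real \<Rightarrow> real"
  assumes sym: "\<And>p. p \<in> {0<..<1} \<Longrightarrow> J (1 - p) = J p"
    and mono: "mono_on {0<..1/2} J"
    and "0 < a" "0 < b" "a \<le> p" "p \<le> 1 - b"
  shows "J (min a b) \<le> J p"
proof (cases "p \<le> 1/2")
  case True
  with assms show ?thesis by (intro mono_onD[OF mono]) auto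
next
  case False
  with assms have "J (min a b) \<le> J (1 - p)" by (intro mono_onD[OF mono]) auto
  with sym[of p] assms show ?thesis by simp
qed

section \<open>From the three-set inequality to the minorant\<close>

lemma three_set_isoperimetricD:
  assumes "three_set_isoperimetric \<pi> d F"
    and "S1 \<in> sets \<pi>" "S2 \<in> sets \<pi>" "S3 \<in> sets \<pi>"
    and "S1 \<union> S2 \<union> S3 = space \<pi>" "S1 \<inter> S2 = {}" "S1 \<inter> S3 = {}" "S2 \<inter> S3 = {}"
    and "0 < measure \<pi> S1" "0 < measure \<pi> S2"
  shows "set_distance d S1 S2 * ereal (F (min (measure \<pi> S1) (measure \<pi> S2)))
    \<le> ereal (measure \<pi> S3)"
  using assms unfolding three_set_isoperimetric_def by blast

text \<open>The measure of the enlargement need not tend to that of \<open>A\<close>. Where it is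
  close, continuity and symmetry of \<open>J\<close> bound the quotient; where it exceeds it by a
  fixed amount, a small \<open>r\<close> makes the quotient large.\<close>

lemma three_set_imp_le_minkowski_content:
  fixes J :: "real \<Rightarrow> real"
  assumes "prob_space \<pi>" and "space \<pi> = UNIV" and metric: "Metric_space UNIV d"
    and enl: "\<And>A r. A \<in> sets \<pi> \<Longrightarrow> r > 0 \<Longrightarrow> enlargement d A r \<in> sets \<pi>"
    and pos: "J \<in> {0<..<1} \<rightarrow> {0<..}"
    and sym: "\<And>p. p \<in> {0<..<1} \<Longrightarrow> J (1 - p) = J p"
    and cont: "continuous_on {0<..<1} J"
    and three: "three_set_isoperimetric \<pi> d J"
    and A: "A \<in> sets \<pi>" "measure \<pi> A \<in> {0<..<1}"
  shows "ereal (J (measure \<pi> A)) \<le> minkowski_content \<pi> d A"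
proof -
  interpret prob_space \<pi> by fact
  define p where "p = prob A"
  have p: "0 < p" "p < 1" using A by (auto simp: p_def)
  \<comment> \<open>Measure below 1 gives the complement of the enlargement positive measure, so it
    can serve as the second set.\<close>
  have quotient: "J (min p (1 - prob (enlargement d A r))) \<le> (prob (enlargement d A r) - p) / r"
    if "r > 0" "prob (enlargement d A r) < 1" for r
  proof -
    let ?E = "enlargement d A r"
    have E: "?E \<in> sets \<pi>" using enl A that by simp
    have sub: "A \<subseteq> ?E" using metric that by (intro subset_enlargement)
    have compl: "- ?E \<in> sets \<pi>" "prob (- ?E) = 1 - prob ?E"
      using sets.compl_sets[OF E] prob_compl[OF E] assms(2) by (simp_all add: Compl_eq_Diff_UNIV)
    have min: "0 < min p (1 - prob ?E)" "min p (1 - prob ?E) < 1"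
      using p that by auto
    have "set_distance d A (- ?E) * ereal (J (min p (1 - prob ?E))) \<le> prob (?E - A)"
      unfolding p_def compl(2)[symmetric]
      using A E sub compl that assms(2)
      by (intro three_set_isoperimetricD[OF three]) auto
    moreover have "ereal r * ereal (J (min p (1 - prob ?E)))
        \<le> set_distance d A (- ?E) * ereal (J (min p (1 - prob ?E)))"
      using le_set_distance_compl_enlargement[OF metric] pos min
      by (intro ereal_mult_right_mono) (auto simp: less_imp_le Pi_iff)
    moreover have "prob (?E - A) = prob ?E - p"
      using finite_measure_Diff[OF E _ sub] A by (simp add: p_def)
    ultimately have "ereal (r * J (min p (1 - prob ?E))) \<le> ereal (prob ?E - p)"
      by (metis order_trans times_ereal.simps(1))
    with that show ?thesis by (simp add: field_simps)
  qed
  have quotient_gt: "\<forall>\<^sub>F r in at_right 0. c < (prob (enlargement d A r) - p) / r" if "c < J p" for c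
  proof -
    define e where "e = J p - c"
    have "e > 0" using that by (simp add: e_def)
    \<comment> \<open>Continuity is taken at \<open>1 - p\<close> because \<open>quotient\<close>
      evaluates \<open>J\<close> at one minus the enlarged measure; symmetry leads back to
      \<open>J p\<close>.\<close>
    have "isCont J (1 - p)"
      using cont p by (simp add: continuous_on_eq_continuous_at)
    then obtain \<delta> where \<delta>: "\<delta> > 0" "\<And>x. \<bar>x - (1 - p)\<bar> < \<delta> \<Longrightarrow> \<bar>J x - J (1 - p)\<bar> < e"
      using \<open>e > 0\<close> unfolding isCont_def LIM_eq
      by (metis abs_zero diff_self real_norm_def)
    \<comment> \<open>The cap \<open>1 - p\<close> ensures that a measure below
      \<open>p + \<eta>\<close> is below 1, as \<open>quotient\<close> requires.\<close>
    define \<eta> where "\<eta> = min \<delta> (1 - p)"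
    have \<eta>: "\<eta> > 0" "\<eta> \<le> \<delta>" "\<eta> \<le> 1 - p" using \<delta> p by (auto simp: \<eta>_def)
    \<comment> \<open>This range forces \<open>c * r < \<eta>\<close>, so a gain of
      \<open>\<eta>\<close> alone pushes the quotient above \<open>c\<close>. The absolute value and
      the 1 cover \<open>c \<le> 0\<close>.\<close>
    have "\<forall>\<^sub>F r in at_right 0. r \<in> {0<..<\<eta> / (\<bar>c\<bar> + 1)}"
      using \<eta> by (intro eventually_at_right_real) simp
    then show ?thesis
    proof eventually_elim
      case (elim r)
      then have "r > 0" and r: "c * r < \<eta>"
      proof -
        from elim show "r > 0" by simp
        have "c * r \<le> (\<bar>c\<bar> + 1) * r" using \<open>r > 0\<close> by (intro mult_right_mono) auto
        also have "\<dots> < \<eta>" using elim by (simp add: field_simps)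
        finally show "c * r < \<eta>" .
      qed
      let ?q = "prob (enlargement d A r)"
      have q: "p \<le> ?q"
        unfolding p_def using metric \<open>r > 0\<close> enl A
        by (intro finite_measure_mono subset_enlargement) auto
      show ?case
      proof (cases "?q < p + \<eta>")
        case True
        have "\<bar>J (1 - ?q) - J (1 - p)\<bar> < e"
          using True \<eta> q by (intro \<delta>) auto
        then have "c < J (1 - ?q)" using sym[of p] p by (simp add: e_def)
        \<comment> \<open>Whichever argument the minimum selects, \<open>J\<close> exceeds
          \<open>c\<close> there.\<close>
        then have "c < J (min p (1 - ?q))" using that by (simp add: min_def)
        also have "\<dots> \<le> (?q - p) / r"
          using True \<eta> \<open>r > 0\<close> by (intro quotient) auto
        finally show ?thesis .
      next
        case False
        with r have "c * r < ?q - p" by simp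
        with \<open>r > 0\<close> show ?thesis by (simp add: field_simps)
      qed
    qed
  qed
  show ?thesis
    unfolding minkowski_content_def p_def[symmetric] le_Liminf_iff
  proof (intro allI impI)
    fix y assume "y < ereal (J p)"
    then show "\<forall>\<^sub>F r in at_right 0. y < ereal ((prob (enlargement d A r) - p) / r)"
      using quotient_gt by (cases y) auto
  qed
qed

section \<open>From the minorant to the three-set inequality\<close>

text \<open>Up to the distance between the two sets, the enlargement of the first avoids the second.
  Its measure thus stays where \<open>J\<close> is at least its value at the smaller of the two
  measures, and its growth is paid for by the third set.\<close>

lemma minorant_imp_three_set:
  fixes J :: "real \<Rightarrow> real"
  assumes "prob_space \<pi>" and "space \<pi> = UNIV" and metric: "Metric_space UNIV d"
    and enl: "\<And>A r. A \<in> sets \<pi> \<Longrightarrow> r > 0 \<Longrightarrow> enlargement d A r \<in> sets \<pi>"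
    and sym: "\<And>p. p \<in> {0<..<1} \<Longrightarrow> J (1 - p) = J p"
    and mono: "mono_on {0<..1/2} J"
    and minorant: "isoperimetric_minorant \<pi> d J"
  shows "three_set_isoperimetric \<pi> d J"
proof -
  interpret prob_space \<pi> by fact
  have pos: "J \<in> {0<..<1} \<rightarrow> {0<..}"
    using minorant by (simp add: isoperimetric_minorant_def)
  have content: "ereal (J (prob A)) \<le> minkowski_content \<pi> d A"
    if "A \<in> sets \<pi>" "prob A \<in> {0<..<1}" for A
  proof -
    have "isoperimetric_profile \<pi> d (prob A) \<le> minkowski_content \<pi> d A"
      unfolding isoperimetric_profile_def using that by (intro INF_lower) auto
    moreover have "ereal (J (prob A)) \<le> isoperimetric_profile \<pi> d (prob A)"
      using minorant that by (simp add: isoperimetric_minorant_def)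
    ultimately show ?thesis by (rule order_trans[rotated])
  qed
  have "set_distance d S T * ereal (J (min (prob S) (prob T))) \<le> ereal (prob R)"
    if sets: "S \<in> sets \<pi>" "T \<in> sets \<pi>" "R \<in> sets \<pi>"
      and part: "S \<union> T \<union> R = UNIV" "S \<inter> T = {}" "S \<inter> R = {}" "T \<inter> R = {}"
      and ps: "0 < prob S" "0 < prob T" for S T R
  proof -
    interpret d: Metric_space UNIV d by fact
    define m where "m = J (min (prob S) (prob T))"
    have total: "prob S + prob T + prob R = 1"
    proof -
      have "prob (S \<union> T \<union> R) = prob (S \<union> T) + prob R"
        using sets part by (intro finite_measure_Union) auto
      also have "prob (S \<union> T) = prob S + prob T"
        using sets part by (intro finite_measure_Union)
      finally show ?thesis using part prob_space assms(2) by simp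
    qed
    have "prob S < 1" using ps total measure_nonneg[of \<pi> R] by linarith
    then have "m > 0"
      unfolding m_def using ps
      by (intro greaterThan_iff[THEN iffD1] Pi_mem[OF pos]) (auto simp: min_less_iff_disj)
    \<comment> \<open>Positive measure makes both sets nonempty, which excludes an infinite
      distance.\<close>
    obtain x y where xy: "x \<in> S" "y \<in> T" using ps by (metis all_not_in_conv less_irrefl measure_empty)
    have "0 \<le> set_distance d S T" by (simp add: le_set_distance_iff)
    moreover have "set_distance d S T \<le> ereal (d x y)"
      using xy le_set_distance_iff[of "set_distance d S T" d S T] by blast
    ultimately obtain D where D: "set_distance d S T = ereal D" "0 \<le> D"
      by (cases "set_distance d S T") auto
    \<comment> \<open>The value at 0 is set by hand: the enlargement of radius 0 is empty, not
      \<open>S\<close>.\<close>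
    define E where "E r = (if r = 0 then S else enlargement d S r)" for r
    define g where "g r = prob (E r)" for r
    have E: "E r \<in> sets \<pi>" if "0 \<le> r" for r
      using that sets enl by (auto simp: E_def)
    have E_mono: "E r \<subseteq> E s" if "0 \<le> r" "r \<le> s" for r s
      using that subset_enlargement[OF metric, of s S] enlargement_mono[of r s d S]
      by (auto simp: E_def)
    have E_add: "enlargement d (E r) s \<subseteq> E (r + s)" if "0 \<le> r" "0 < s" for r s
      using that enlargement_enlargement_subset[OF metric, of S r s] by (auto simp: E_def)
    have E_T: "E r \<inter> T = {}" if "r \<le> D" for r
      using that enlargement_disjoint[OF metric, of r S T] D part by (auto simp: E_def)
    have g_bounds: "prob S \<le> g r" "g r \<le> prob S + prob R" if "0 \<le> r" "r \<le> D" for r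
    proof -
      show "prob S \<le> g r"
        using E_mono[of 0 r] E that unfolding g_def
        by (intro finite_measure_mono) (auto simp: E_def)
      have "E r \<subseteq> S \<union> R" using E_T[of r] part that by auto
      then have "g r \<le> prob (S \<union> R)"
        unfolding g_def using sets by (intro finite_measure_mono) auto
      also have "\<dots> = prob S + prob R"
        using sets part by (intro finite_measure_Union)
      finally show "g r \<le> prob S + prob R" .
    qed
    have "m * (D - 0) \<le> g D - g 0"
    proof (rule mono_Dini_lower_bound)
      show "mono_on {0..D} g"
        unfolding g_def by (intro mono_onI finite_measure_mono E_mono E) auto
    next
      fix t assume t: "t \<in> {0..<D}"
      have gt: "prob S \<le> g t" "g t \<le> 1 - prob T"
        using g_bounds[of t] t total by auto
      have "m \<le> J (g t)"
        unfolding m_def using sym mono ps gt by (rule symmetric_mono_ge_min)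
      then have "ereal m \<le> ereal (J (g t))" by simp
      also have "\<dots> \<le> minkowski_content \<pi> d (E t)"
        unfolding g_def using E t gt ps by (intro content) (auto simp: g_def)
      \<comment> \<open>The content of \<open>E t\<close> concerns enlargements of
        \<open>E t\<close>, which lie in \<open>E (t + s)\<close>; its quotients are therefore at
        most those of \<open>g\<close>.\<close>
      also have "\<dots> \<le> Liminf (at_right 0) (\<lambda>s. ereal ((g (t + s) - g t) / s))"
        unfolding minkowski_content_def
      proof (rule Liminf_mono)
        show "\<forall>\<^sub>F s in at_right 0. ereal ((prob (enlargement d (E t) s) - prob (E t)) / s)
            \<le> ereal ((g (t + s) - g t) / s)"
          using eventually_at_right_less[of 0]
        proof eventually_elim
          case (elim s)
          then have "prob (enlargement d (E t) s) \<le> g (t + s)"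
            unfolding g_def using t E_add E by (intro finite_measure_mono) auto
          with elim show ?case by (simp add: g_def divide_right_mono)
        qed
      qed
      finally show "ereal m \<le> Liminf (at_right 0) (\<lambda>s. ereal ((g (t + s) - g t) / s))" .
    qed (use D \<open>m > 0\<close> in auto)
    moreover have "g 0 = prob S" by (simp add: g_def E_def)
    ultimately have "D * m \<le> prob R" using g_bounds[of D] D by (simp add: mult.commute)
    then show ?thesis by (simp add: D m_def)
  qed
  then show ?thesis
    using pos assms(2) unfolding three_set_isoperimetric_def
    by (auto simp: Pi_iff less_imp_le)
qed

theorem lemma14:
  fixes \<pi> :: "(real ^ 'n) measure"
    and \<rho> :: "real ^ 'n \<Rightarrow> real"
    and d :: "real ^ 'n \<Rightarrow> real ^ 'n \<Rightarrow> real"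
    and J :: "real \<Rightarrow> real"
  assumes "prob_space \<pi>"
    and "\<rho> \<in> borel_measurable borel"
    and "\<And>x. \<rho> x > 0"
    and "\<pi> = density lborel (\<lambda>x. ennreal (\<rho> x))"
    and "Metric_space UNIV d"
    and "\<And>A r. A \<in> sets borel \<Longrightarrow> r > 0 \<Longrightarrow> enlargement d A r \<in> sets borel"
    and "J \<in> {0<..<1} \<rightarrow> {0<..}"
    and "\<And>p. p \<in> {0<..<1} \<Longrightarrow> J (1 - p) = J p"
    and "continuous_on {0<..<1} J"
    and "mono_on {0<..1/2} J"
  shows "regular_isoperimetric_minorant \<pi> d J \<longleftrightarrow> three_set_isoperimetric \<pi> d J"
proof -
  interpret prob_space \<pi> by fact
  have sets: "sets \<pi> = sets borel" and space: "space \<pi> = UNIV"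
    by (simp_all add: assms(4))
  have enl: "\<And>A r. A \<in> sets \<pi> \<Longrightarrow> r > 0 \<Longrightarrow> enlargement d A r \<in> sets \<pi>"
    using assms(6) by (simp add: sets)
  show ?thesis
  proof
    assume "regular_isoperimetric_minorant \<pi> d J"
    then have "isoperimetric_minorant \<pi> d J"
      by (simp add: regular_isoperimetric_minorant_def)
    with assms(1) space assms(5) enl assms(8,10) show "three_set_isoperimetric \<pi> d J"
      by (rule minorant_imp_three_set)
  next
    assume three: "three_set_isoperimetric \<pi> d J"
    \<comment> \<open>The regularity clauses are hypotheses on \<open>J\<close>, so only the bound
      by the profile remains, one competitor at a time.\<close>
    have "ereal (J p) \<le> isoperimetric_profile \<pi> d p" if "p \<in> {0<..<1}" for p
      unfolding isoperimetric_profile_def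
    proof (rule INF_greatest)
      fix A assume "A \<in> {A \<in> sets \<pi>. prob A = p}"
      with that three_set_imp_le_minkowski_content[OF assms(1) space assms(5) enl assms(7-9) three]
      show "ereal (J p) \<le> minkowski_content \<pi> d A" by auto
    qed
    with assms(7-10) show "regular_isoperimetric_minorant \<pi> d J"
      by (simp add: regular_isoperimetric_minorant_def isoperimetric_minorant_def)
  qed
qed

end
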